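(* Let $Z_1,Z_2,\dots$ be i.i.d. random variables (with generic copy $Z$), let $T$ be a stopping time associated with this sequence, and let $S_T:=Z_1+\dots+Z_T$. If there exists a real function $u\mapsto w_u$ such that $\mathbb{E}(e^{w_uZ})=u^{-1}$ and $\tilde{\mathbb{P}}_{w_u}$ is a probability measure with $\mathbb{P}(T<\infty)=\tilde{\mathbb{P}}_{w_u}(T<\infty)=1$, then $$\mathbb{E}\left(u^{T}e^{xS_T}\right)=\tilde{\mathbb{E}}_{w_u}\left(e^{(x-w_u)S_T}\right)$$ for all real $u,x$ such that the expectations $\mathbb{E}\left(u^{T}e^{xS_T}\right)$ and $\tilde{\mathbb{E}}_{w_u}\left(e^{(x-w_u)S_T}\right)$ exist. In particular, $\mathbb{E}(u^{T})=\tilde{\mathbb{E}}_{w_u}\left(e^{-w_uS_T}\right)$.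
   Context: Let $F$ be a probability distribution on $\mathbf{R}$ with $\int_{\mathbf{R}} e^{wz}\,dF(z)<\infty$ for all $w$ in an interval $\mathcal{W}$ containing $0$. Let $\Omega=\mathbf{R}^{\mathbf{N}}$, $\mathbf{N}=\{1,2,\dots\}$, let $Z_i:\Omega\to\mathbf{R}$, $Z_i(\mathbf{x})=x_i$, be the coordinate maps, and let $\mathcal{F}=\sigma(Z_1,Z_2,\dots)$. For $w\in\mathcal{W}$, let $F(\cdot|w)$ be the exponentially tilted distribution $F(x|w)=\int_{(-\infty,x]}e^{wz}\,dF(z)\big/\int_{\mathbf{R}}e^{wz}\,dF(z)$, $x\in\mathbf{R}$, and let $\tilde{\mathbb{P}}_w$ be the (product) probability measure on $(\Omega,\mathcal{F})$ under which $Z_1,Z_2,\dots$ are independent with common distribution $F(\cdot|w)$. Write $\mathbb{P}:=\tilde{\mathbb{P}}_0$ (so $Z_i\sim F$ under $\mathbb{P}$), $\tilde{\mathbb{E}}_w$ for expectation under $\tilde{\mathbb{P}}_w$, and $\mathbb{E}:=\tilde{\mathbb{E}}_0$. Let $\mathcal{F}_n=\sigma(Z_1,\dots,Z_n)$. A stopping time associated with $Z_1,Z_2,\dots$ is a map $T:\Omega\to\{1,2,\dots\}\cup\{\infty\}$ with $[T=n]\in\mathcal{F}_n$ for every $n=1,2,\dots$. Here $u$ ranges over the (positive) reals in the domain of the function $u\mapsto w_u$, with $w_u\in\mathcal{W}$, and an expectation "exists" when the integrand is (absolutely) integrable. *)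

theory Defs
  imports "HOL-Probability.Probability" "HOL-Library.Extended_Nat"
begin

definition tilted_cdf :: "real measure \<Rightarrow> real \<Rightarrow> real \<Rightarrow> real" where
  "tilted_cdf F w x = (LINT z:{..x}|F. exp (w * z)) / (LINT z|F. exp (w * z))"

definition tilted_distr :: "real measure \<Rightarrow> real \<Rightarrow> real measure" where
  "tilted_distr F w = interval_measure (tilted_cdf F w)"

text \<open>
  Sequences are indexed by the positive integers. As usual for \<^const>\<open>PiM\<close>, the sample space
  consists of the functions on \<^typ>\<open>nat\<close> that are \<^const>\<open>undefined\<close> at the index 0.
\<close>

definition seq_space :: "(nat \<Rightarrow> real) measure" where
  "seq_space = (\<Pi>\<^sub>M i\<in>{1..}. borel)"

definition coord :: "nat \<Rightarrow> (nat \<Rightarrow> real) \<Rightarrow> real" where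
  "coord i \<omega> = \<omega> i"

definition tilted_prob :: "real measure \<Rightarrow> real \<Rightarrow> (nat \<Rightarrow> real) measure" where
  "tilted_prob F w = (\<Pi>\<^sub>M i\<in>{1..}. tilted_distr F w)"

definition coord_filtration :: "nat \<Rightarrow> (nat \<Rightarrow> real) measure" where
  "coord_filtration n = sigma (space seq_space)
     {coord i -` A \<inter> space seq_space | i A. i \<in> {1..n} \<and> A \<in> sets borel}"

definition coord_stopping_time :: "((nat \<Rightarrow> real) \<Rightarrow> enat) \<Rightarrow> bool" where
  "coord_stopping_time T \<longleftrightarrow>
     (\<forall>\<omega>\<in>space seq_space. 1 \<le> T \<omega>) \<and>
     (\<forall>n\<ge>1. {\<omega> \<in> space seq_space. T \<omega> = enat n} \<in> sets (coord_filtration n))"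

text \<open>
  The stopped sum, and likewise the power \<open>u ^ the_enat (T \<omega>)\<close>, is an arbitrary fixed value
  on the event \<open>T = \<infinity>\<close>, so the two are meaningful only where that event is null.
\<close>

definition stopped_sum :: "((nat \<Rightarrow> real) \<Rightarrow> enat) \<Rightarrow> (nat \<Rightarrow> real) \<Rightarrow> real" where
  "stopped_sum T \<omega> = (\<Sum>i = 1..the_enat (T \<omega>). coord i \<omega>)"

text \<open>
  \<^const>\<open>interval_measure\<close> has the intended meaning only for nondecreasing right-continuous
  functions; the following shows that this is the case here.
\<close>

lemma tilted_distr_eq_density:
  assumes "real_distribution F" and int: "integrable F (\<lambda>z. exp (w * z))"
  shows "tilted_distr F w = density F (\<lambda>z. ennreal (exp (w * z) / (LINT z|F. exp (w * z))))"
    and "real_distribution (tilted_distr F w)"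
    and "cdf (tilted_distr F w) = tilted_cdf F w"
proof -
  interpret F: real_distribution F by fact
  define c where "c = (LINT z|F. exp (w * z))"
  have "c \<noteq> 0"
  proof
    assume "c = 0"
    then have "AE z in F. exp (w * z) = 0"
      using integral_nonneg_eq_0_iff_AE[OF int] by (simp add: c_def)
    then show False by simp
  qed
  moreover have "c \<ge> 0" by (simp add: c_def)
  ultimately have c: "c > 0" by simp
  define D where "D = density F (\<lambda>z. ennreal (exp (w * z) / c))"
  have intc: "integrable F (\<lambda>z. exp (w * z) / c)" using int by simp
  have D1: "emeasure D A = ennreal ((LINT z:A|F. exp (w * z)) / c)" if "A \<in> sets borel" for A
  proof -
    have "emeasure D A = (\<integral>\<^sup>+z. ennreal (indicator A z * (exp (w * z) / c)) \<partial>F)"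
      using that unfolding D_def
      by (subst emeasure_density) (auto intro!: nn_integral_cong split: split_indicator)
    also have "\<dots> = ennreal (LINT z|F. indicator A z * (exp (w * z) / c))"
      using that c intc
      by (intro nn_integral_eq_integral integrable_real_mult_indicator
            integrable_mult_indicator[where 'b = real, simplified]) auto
    finally show ?thesis by (simp add: set_lebesgue_integral_def)
  qed
  have "prob_space D"
    using D1[of UNIV] c by (intro prob_spaceI) (simp add: D_def set_lebesgue_integral_def c_def)
  then interpret D: prob_space D .
  have D: "real_distribution D"
    by unfold_locales (simp_all add: D_def)
  then interpret D: real_distribution D .
  have cdfD: "cdf D = tilted_cdf F w"
  proof
    fix x
    have "0 \<le> (LINT z:{..x}|F. exp (w * z)) / c"
      using c by (simp add: set_lebesgue_integral_def)
    then show "cdf D x = tilted_cdf F w x"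
      using D1[of "{..x}"] by (simp add: cdf_def measure_def tilted_cdf_def c_def)
  qed
  have "real_distribution (interval_measure (cdf D))"
    by (intro real_distribution_interval_measure D.cdf_nondecreasing D.cdf_is_right_cont
          D.cdf_lim_at_bot D.cdf_lim_at_top_prob)
  moreover have "cdf (interval_measure (cdf D)) = cdf D"
    by (intro cdf_interval_measure D.cdf_nondecreasing D.cdf_is_right_cont D.cdf_lim_at_bot)
  ultimately have "interval_measure (cdf D) = D"
    using D by (intro cdf_unique)
  then have "tilted_distr F w = D" by (simp add: tilted_distr_def cdfD)
  then show "tilted_distr F w = density F (\<lambda>z. ennreal (exp (w * z) / (LINT z|F. exp (w * z))))"
    and "real_distribution (tilted_distr F w)"
    and "cdf (tilted_distr F w) = tilted_cdf F w"
    using D cdfD by (simp_all add: D_def c_def)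
qed

end

theory Submission
  imports Defs
begin

text \<open>
  The theorem is Wald's likelihood ratio identity. Passing from the law \<open>F\<close> to its tilt multiplies
  the law of one coordinate by the density \<open>z \<mapsto> u * exp (w u * z)\<close>, because the
  normalising constant is \<open>E (exp (w u * Z)) = 1 / u\<close>. By independence the law of the first
  \<open>n\<close> coordinates is multiplied by \<open>u ^ n * exp (w u * S\<^sub>n)\<close>. The two infinite product
  measures are mutually singular unless \<open>F(\<cdot>|w u) = F\<close>, so no density exists on the whole
  sequence space; but the event \<open>T = n\<close>, and on it the integrand, depends only on the first
  \<open>n\<close> coordinates. Hence on that event
  \<open>u ^ n * exp (x * S\<^sub>n) = (u ^ n * exp (w u * S\<^sub>n)) * exp ((x - w u) * S\<^sub>n)\<close> can be integrated by
  change of measure, and summing over \<open>n\<close> gives the claim because \<open>T\<close> is almost surely finite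
  under both measures.

  Finite-dimensional change of measure is \<open>nn_integral_PiM_density_restrict\<close>, its stopped version
  is \<open>nn_integral_stopped_PiM_density\<close>. Both are stated for nonnegative extended integrals, where
  the summation over \<open>n\<close> is free of convergence conditions; the integrands of the theorem are
  nonnegative, so the result transfers to Bochner integrals.
\<close>

section \<open>Change of measure in finitely many coordinates\<close>

lemma density_PiM_prod:
  assumes I: "finite I"
    and M: "\<And>i. sigma_finite_measure (M i)"
    and g [measurable]: "\<And>i. g i \<in> borel_measurable (M i)"
    and N: "\<And>i. sigma_finite_measure (density (M i) (g i))"
  shows "density (PiM I M) (\<lambda>x. \<Prod>i\<in>I. g i (x i)) = PiM I (\<lambda>i. density (M i) (g i))"
proof -
  interpret M: product_sigma_finite M
    using M by (simp add: product_sigma_finite_def)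
  interpret N: product_sigma_finite "\<lambda>i. density (M i) (g i)"
    using N by (simp add: product_sigma_finite_def)
  show ?thesis
  proof (rule N.PiM_eqI[OF I])
    show "sets (density (PiM I M) (\<lambda>x. \<Prod>i\<in>I. g i (x i))) = sets (PiM I (\<lambda>i. density (M i) (g i)))"
      by (simp cong: sets_PiM_cong)
  next
    fix A assume "\<And>i. i \<in> I \<Longrightarrow> A i \<in> sets (density (M i) (g i))"
    then have A [measurable]: "\<And>i. i \<in> I \<Longrightarrow> A i \<in> sets (M i)"
      by simp
    have PiE: "Pi\<^sub>E I A \<in> sets (PiM I M)"
      using I A by (rule sets_PiM_I_finite)
    have "emeasure (density (PiM I M) (\<lambda>x. \<Prod>i\<in>I. g i (x i))) (Pi\<^sub>E I A) =
        (\<integral>\<^sup>+x. (\<Prod>i\<in>I. g i (x i)) * indicator (Pi\<^sub>E I A) x \<partial>PiM I M)"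
      using PiE by (intro emeasure_density) auto
    also have "\<dots> = (\<integral>\<^sup>+x. (\<Prod>i\<in>I. g i (x i) * indicator (A i) (x i)) \<partial>PiM I M)"
    proof (rule nn_integral_cong)
      fix x assume x: "x \<in> space (PiM I M)"
      have "indicator (Pi\<^sub>E I A) x = (\<Prod>i\<in>I. indicator (A i) (x i) :: ennreal)"
      proof (cases "\<forall>i\<in>I. x i \<in> A i")
        case True
        with x show ?thesis by (auto simp: space_PiM PiE_iff)
      next
        case False
        then obtain i where i: "i \<in> I" "x i \<notin> A i" by blast
        then have *: "(\<Prod>i\<in>I. indicator (A i) (x i) :: ennreal) = 0"
          using I by (intro prod_zero bexI[of _ i]) auto
        from i have "x \<notin> Pi\<^sub>E I A" by auto
        then show ?thesis unfolding * by (rule indicator_simps(2))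
      qed
      then show "(\<Prod>i\<in>I. g i (x i)) * indicator (Pi\<^sub>E I A) x =
          (\<Prod>i\<in>I. g i (x i) * indicator (A i) (x i))"
        by (simp add: prod.distrib)
    qed
    also have "\<dots> = (\<Prod>i\<in>I. \<integral>\<^sup>+z. g i z * indicator (A i) z \<partial>M i)"
      using I by (intro M.product_nn_integral_prod) auto
    also have "\<dots> = (\<Prod>i\<in>I. emeasure (density (M i) (g i)) (A i))"
      by (intro prod.cong refl emeasure_density[symmetric]) auto
    finally show "emeasure (density (PiM I M) (\<lambda>x. \<Prod>i\<in>I. g i (x i))) (Pi\<^sub>E I A) =
        (\<Prod>i\<in>I. emeasure (density (M i) (g i)) (A i))" .
  qed
qed

text \<open>
  For infinite \<open>I\<close> a density of one product with respect to the other need not exist, but the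
  finite-dimensional marginals always have one.
\<close>

lemma nn_integral_PiM_density_restrict:
  assumes J: "finite J" "J \<subseteq> I"
    and M: "\<And>i. prob_space (M i)"
    and g [measurable]: "\<And>i. g i \<in> borel_measurable (M i)"
    and N: "\<And>i. prob_space (density (M i) (g i))"
    and h [measurable]: "h \<in> borel_measurable (PiM J M)"
  shows "(\<integral>\<^sup>+x. h (restrict x J) \<partial>PiM I (\<lambda>i. density (M i) (g i))) =
    (\<integral>\<^sup>+x. (\<Prod>i\<in>J. g i (x i)) * h (restrict x J) \<partial>PiM I M)"
proof -
  let ?N = "\<lambda>i. density (M i) (g i)"
  have M': "sigma_finite_measure (M i)" and N': "sigma_finite_measure (?N i)" for i
    using M N by (simp_all add: prob_space_imp_sigma_finite)
  interpret M: product_prob_space M I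
    using M M' by (simp add: product_prob_space_def product_prob_space_axioms_def product_sigma_finite_def)
  interpret N: product_prob_space ?N I
    using N N' by (simp add: product_prob_space_def product_prob_space_axioms_def product_sigma_finite_def)
  have sets_N: "sets (PiM J ?N) = sets (PiM J M)"
    by (simp cong: sets_PiM_cong)
  have h_N: "h \<in> borel_measurable (PiM J ?N)"
    using h by (simp add: measurable_cong_sets[OF sets_N refl])
  have prod [measurable]: "(\<lambda>y. \<Prod>i\<in>J. g i (y i)) \<in> borel_measurable (PiM J M)"
    by measurable
  have "(\<integral>\<^sup>+x. h (restrict x J) \<partial>PiM I ?N) =
      (\<integral>\<^sup>+y. h y \<partial>distr (PiM I ?N) (PiM J ?N) (\<lambda>x. restrict x J))"
    using h_N J by (intro nn_integral_distr[symmetric] measurable_restrict_subset) auto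
  also have "\<dots> = (\<integral>\<^sup>+y. h y \<partial>density (PiM J M) (\<lambda>y. \<Prod>i\<in>J. g i (y i)))"
    by (simp add: N.distr_PiM_restrict_finite[OF J] density_PiM_prod[OF J(1) M' g N'])
  also have "\<dots> = (\<integral>\<^sup>+y. (\<Prod>i\<in>J. g i (y i)) * h y \<partial>PiM J M)"
    by (rule nn_integral_density) measurable
  also have "\<dots> = (\<integral>\<^sup>+y. (\<Prod>i\<in>J. g i (y i)) * h y \<partial>distr (PiM I M) (PiM J M) (\<lambda>x. restrict x J))"
    by (simp add: M.distr_PiM_restrict_finite[OF J])
  also have "\<dots> = (\<integral>\<^sup>+x. (\<Prod>i\<in>J. g i (restrict x J i)) * h (restrict x J) \<partial>PiM I M)"
    using J by (intro nn_integral_distr measurable_restrict_subset) auto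
  also have "\<dots> = (\<integral>\<^sup>+x. (\<Prod>i\<in>J. g i (x i)) * h (restrict x J) \<partial>PiM I M)"
    by simp
  finally show ?thesis .
qed

section \<open>Stopping times of the coordinate filtration\<close>

text \<open>
  This turns \<open>\<F>\<^sub>n\<close>-measurability into a genuine function of the first \<open>n\<close> coordinates, the form in
  which the finite-dimensional change of measure applies.
\<close>

lemma coord_filtration_cylinder:
  assumes "A \<in> sets (coord_filtration n)"
  obtains B where "B \<in> sets (PiM {1..n} (\<lambda>_. borel))"
    and "A = (\<lambda>\<omega>. restrict \<omega> {1..n}) -` B \<inter> space seq_space"
proof -
  let ?P = "PiM {1..n} (\<lambda>_. borel :: real measure)"
  let ?r = "\<lambda>\<omega>::nat \<Rightarrow> real. restrict \<omega> {1..n}"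
  let ?V = "vimage_algebra (space seq_space) ?r ?P"
  let ?C = "{coord i -` A \<inter> space seq_space | i A. i \<in> {1..n} \<and> A \<in> sets borel}"
  have r: "?r \<in> space seq_space \<rightarrow> space ?P"
    by (auto simp: seq_space_def space_PiM)
  have "?C \<subseteq> sets ?V"
  proof
    fix X assume "X \<in> ?C"
    then obtain i A where i: "i \<in> {1..n}" and A: "A \<in> sets borel"
      and X: "X = coord i -` A \<inter> space seq_space" by blast
    have "(\<lambda>y. y i) -` A \<inter> space ?P \<in> sets ?P"
      using i A by (intro measurable_sets[OF measurable_component_singleton]) auto
    then have "?r -` ((\<lambda>y. y i) -` A \<inter> space ?P) \<inter> space seq_space \<in> sets ?V"
      by (rule in_vimage_algebra)
    also have "?r -` ((\<lambda>y. y i) -` A \<inter> space ?P) \<inter> space seq_space = X"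
      using i r by (auto simp: X coord_def)
    finally show "X \<in> sets ?V" .
  qed
  then have "sigma_sets (space seq_space) ?C \<subseteq> sets ?V"
    using sets.sigma_sets_subset[of ?C ?V] by simp
  moreover have "sets (coord_filtration n) = sigma_sets (space seq_space) ?C"
    unfolding coord_filtration_def by (rule sets_measure_of) auto
  ultimately have "A \<in> sets ?V"
    using assms by blast
  then show ?thesis
    using that unfolding sets_vimage_algebra2[OF r] by blast
qed

lemma coord_stopping_time_event:
  assumes T: "coord_stopping_time T"
  obtains B where "B \<in> sets (PiM {1..n} (\<lambda>_. borel))"
    and "{\<omega> \<in> space seq_space. T \<omega> = enat n} = (\<lambda>\<omega>. restrict \<omega> {1..n}) -` B \<inter> space seq_space"
proof (cases "n \<ge> 1")
  case True
  with T have "{\<omega> \<in> space seq_space. T \<omega> = enat n} \<in> sets (coord_filtration n)"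
    by (simp add: coord_stopping_time_def)
  then show ?thesis
    by (rule coord_filtration_cylinder) (rule that)
next
  \<comment> \<open>A stopping time is at least 1, so the event \<open>T = 0\<close> is empty.\<close>
  case False
  then have "{\<omega> \<in> space seq_space. T \<omega> = enat n} = {}"
    using T by (auto simp: coord_stopping_time_def one_enat_def)
  then show ?thesis
    using that[of "{}"] by simp
qed

lemma coord_stopping_time_event_sets:
  assumes T: "coord_stopping_time T"
  shows "{\<omega> \<in> space seq_space. T \<omega> = enat n} \<in> sets seq_space"
proof (rule coord_stopping_time_event[OF T])
  fix B assume B: "B \<in> sets (PiM {1..n} (\<lambda>_. borel))"
    and eq: "{\<omega> \<in> space seq_space. T \<omega> = enat n} =
      (\<lambda>\<omega>. restrict \<omega> {1..n}) -` B \<inter> space seq_space"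
  have "(\<lambda>\<omega>. restrict \<omega> {1..n}) \<in> measurable seq_space (PiM {1..n} (\<lambda>_. borel :: real measure))"
    unfolding seq_space_def by (rule measurable_restrict_subset) auto
  then show ?thesis
    unfolding eq using B by (rule measurable_sets)
qed

lemma coord_stopping_time_measurable:
  assumes "coord_stopping_time T"
  shows "T \<in> measurable seq_space (count_space UNIV)"
proof -
  have fin: "T -` {enat n} \<inter> space seq_space \<in> sets seq_space" for n
  proof -
    have "T -` {enat n} \<inter> space seq_space = {\<omega> \<in> space seq_space. T \<omega> = enat n}"
      by auto
    then show ?thesis
      using coord_stopping_time_event_sets[OF assms] by simp
  qed
  have "T -` {\<infinity>} \<inter> space seq_space = space seq_space - (\<Union>n. T -` {enat n} \<inter> space seq_space)"
    by auto
  moreover have "\<dots> \<in> sets seq_space"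
    using fin by (intro sets.Diff sets.top sets.countable_UN) auto
  ultimately have "T -` {k} \<inter> space seq_space \<in> sets seq_space" for k
    using fin by (cases k) auto
  then show ?thesis
    by (simp add: measurable_count_space_eq2_countable)
qed

section \<open>Change of measure up to a stopping time\<close>

text \<open>
  On \<open>T = \<infinity>\<close> all terms on the right vanish, whereas \<^const>\<open>the_enat\<close> gives the left-hand side
  an arbitrary value there; this is where almost sure finiteness enters.
\<close>

lemma nn_integral_eq_suminf_stopping:
  fixes f :: "nat \<Rightarrow> 'a \<Rightarrow> ennreal"
  assumes [measurable]: "\<And>n. {\<omega> \<in> space M. T \<omega> = enat n} \<in> sets M" "\<And>n. f n \<in> borel_measurable M"
    and fin: "AE \<omega> in M. T \<omega> < \<infinity>"
  shows "(\<integral>\<^sup>+\<omega>. f (the_enat (T \<omega>)) \<omega> \<partial>M) =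
    (\<Sum>n. \<integral>\<^sup>+\<omega>. f n \<omega> * indicator {\<omega> \<in> space M. T \<omega> = enat n} \<omega> \<partial>M)"
proof -
  have "(\<integral>\<^sup>+\<omega>. f (the_enat (T \<omega>)) \<omega> \<partial>M) =
      (\<integral>\<^sup>+\<omega>. (\<Sum>n. f n \<omega> * indicator {\<omega> \<in> space M. T \<omega> = enat n} \<omega>) \<partial>M)"
  proof (rule nn_integral_cong_AE)
    show "AE \<omega> in M. f (the_enat (T \<omega>)) \<omega> =
        (\<Sum>n. f n \<omega> * indicator {\<omega> \<in> space M. T \<omega> = enat n} \<omega>)"
      using fin AE_space
    proof eventually_elim
      fix \<omega> assume "T \<omega> < \<infinity>" and \<omega>: "\<omega> \<in> space M"
      then obtain k where k: "T \<omega> = enat k" by auto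
      have "(\<Sum>n. f n \<omega> * indicator {\<omega> \<in> space M. T \<omega> = enat n} \<omega>) =
          (\<Sum>n\<in>{k}. f n \<omega> * indicator {\<omega> \<in> space M. T \<omega> = enat n} \<omega>)"
        by (rule suminf_finite) (auto simp: k)
      with k \<omega> show "f (the_enat (T \<omega>)) \<omega> =
          (\<Sum>n. f n \<omega> * indicator {\<omega> \<in> space M. T \<omega> = enat n} \<omega>)"
        by simp
    qed
  qed
  also have "\<dots> = (\<Sum>n. \<integral>\<^sup>+\<omega>. f n \<omega> * indicator {\<omega> \<in> space M. T \<omega> = enat n} \<omega> \<partial>M)"
    by (intro nn_integral_suminf) measurable
  finally show ?thesis .
qed

text \<open>
  Splitting by the value of \<open>T\<close> leaves, for each \<open>n\<close>, an integrand in the first \<open>n\<close> coordinates, to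
  which the finite-dimensional change of measure applies. The density changes with \<open>n\<close>, and
  collecting the pieces evaluates the likelihood ratio at the random time \<open>T\<close>.
\<close>

lemma nn_integral_stopped_PiM_density:
  fixes F :: "real measure" and g :: "real \<Rightarrow> ennreal" and f :: "nat \<Rightarrow> (nat \<Rightarrow> real) \<Rightarrow> ennreal"
  assumes F: "real_distribution F" and g [measurable]: "g \<in> borel_measurable borel"
    and G: "real_distribution (density F g)"
    and T: "coord_stopping_time T"
    and f: "\<And>n. f n \<in> borel_measurable (PiM {1..n} (\<lambda>_. borel))"
    and fin_F: "AE \<omega> in PiM {1..} (\<lambda>_. F). T \<omega> < \<infinity>"
    and fin_G: "AE \<omega> in PiM {1..} (\<lambda>_. density F g). T \<omega> < \<infinity>"
  shows "(\<integral>\<^sup>+\<omega>. f (the_enat (T \<omega>)) (restrict \<omega> {1..the_enat (T \<omega>)}) \<partial>PiM {1..} (\<lambda>_. density F g)) =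
    (\<integral>\<^sup>+\<omega>. (\<Prod>i = 1..the_enat (T \<omega>). g (\<omega> i)) *
        f (the_enat (T \<omega>)) (restrict \<omega> {1..the_enat (T \<omega>)}) \<partial>PiM {1..} (\<lambda>_. F))"
proof -
  interpret F: real_distribution F by fact
  interpret G: real_distribution "density F g" by fact
  let ?P = "PiM {1::nat..} (\<lambda>_. F)" and ?Q = "PiM {1::nat..} (\<lambda>_. density F g)"
  have sets_P: "sets ?P = sets seq_space" and sets_Q: "sets ?Q = sets seq_space"
    by (simp_all add: seq_space_def cong: sets_PiM_cong)
  note spaces = sets_eq_imp_space_eq[OF sets_P] sets_eq_imp_space_eq[OF sets_Q]
  have ev: "{\<omega> \<in> space seq_space. T \<omega> = enat n} \<in> sets seq_space" for n
    using T by (rule coord_stopping_time_event_sets)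
  have "(\<lambda>\<omega>. restrict \<omega> {1..n}) \<in> measurable seq_space (PiM {1..n} (\<lambda>_. borel :: real measure))" for n
    unfolding seq_space_def by (rule measurable_restrict_subset) auto
  then have fr: "(\<lambda>\<omega>. f n (restrict \<omega> {1..n})) \<in> borel_measurable seq_space" for n
    using f by (rule measurable_compose)
  have gp: "(\<lambda>\<omega>. \<Prod>i = 1..n. g (\<omega> i)) \<in> borel_measurable seq_space" for n
    unfolding seq_space_def by measurable
  have step: "(\<integral>\<^sup>+\<omega>. f n (restrict \<omega> {1..n}) * indicator {\<omega> \<in> space ?Q. T \<omega> = enat n} \<omega> \<partial>?Q) =
      (\<integral>\<^sup>+\<omega>. ((\<Prod>i = 1..n. g (\<omega> i)) * f n (restrict \<omega> {1..n})) *
        indicator {\<omega> \<in> space ?P. T \<omega> = enat n} \<omega> \<partial>?P)" for n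
  proof (rule coord_stopping_time_event[OF T, of n])
    fix B assume B: "B \<in> sets (PiM {1..n} (\<lambda>_. borel :: real measure))"
      and eq: "{\<omega> \<in> space seq_space. T \<omega> = enat n} =
        (\<lambda>\<omega>. restrict \<omega> {1..n}) -` B \<inter> space seq_space"
    define h where "h y = f n y * indicator B y" for y
    have sets_n: "sets (PiM {1..n} (\<lambda>_. F)) = sets (PiM {1..n} (\<lambda>_. borel :: real measure))"
      by (simp cong: sets_PiM_cong)
    have h: "h \<in> borel_measurable (PiM {1..n} (\<lambda>_. F))"
      unfolding h_def measurable_cong_sets[OF sets_n refl]
      using f[of n] B by (intro borel_measurable_times_ennreal) auto
    have h_eq: "f n (restrict \<omega> {1..n}) * indicator {\<omega> \<in> space seq_space. T \<omega> = enat n} \<omega> =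
        h (restrict \<omega> {1..n})" if "\<omega> \<in> space seq_space" for \<omega>
      using that unfolding eq h_def by (simp add: indicator_def)
    have "(\<integral>\<^sup>+\<omega>. f n (restrict \<omega> {1..n}) * indicator {\<omega> \<in> space ?Q. T \<omega> = enat n} \<omega> \<partial>?Q) =
        (\<integral>\<^sup>+\<omega>. h (restrict \<omega> {1..n}) \<partial>?Q)"
      by (intro nn_integral_cong) (simp add: spaces h_eq del: One_nat_def)
    also have "\<dots> = (\<integral>\<^sup>+\<omega>. (\<Prod>i = 1..n. g (\<omega> i)) * h (restrict \<omega> {1..n}) \<partial>?P)"
      using h F.prob_space_axioms G.prob_space_axioms
      by (intro nn_integral_PiM_density_restrict) auto
    also have "\<dots> = (\<integral>\<^sup>+\<omega>. ((\<Prod>i = 1..n. g (\<omega> i)) * f n (restrict \<omega> {1..n})) *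
        indicator {\<omega> \<in> space ?P. T \<omega> = enat n} \<omega> \<partial>?P)"
      by (intro nn_integral_cong) (simp add: spaces h_eq[symmetric] mult.assoc del: One_nat_def)
    finally show ?thesis .
  qed
  have "(\<integral>\<^sup>+\<omega>. f (the_enat (T \<omega>)) (restrict \<omega> {1..the_enat (T \<omega>)}) \<partial>?Q) =
      (\<Sum>n. \<integral>\<^sup>+\<omega>. f n (restrict \<omega> {1..n}) * indicator {\<omega> \<in> space ?Q. T \<omega> = enat n} \<omega> \<partial>?Q)"
    using ev fr fin_G
    by (intro nn_integral_eq_suminf_stopping[where f = "\<lambda>n \<omega>. f n (restrict \<omega> {1..n})"])
      (simp_all add: spaces sets_Q measurable_cong_sets[OF sets_Q refl] del: One_nat_def)
  also have "\<dots> = (\<Sum>n. \<integral>\<^sup>+\<omega>. ((\<Prod>i = 1..n. g (\<omega> i)) * f n (restrict \<omega> {1..n})) *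
        indicator {\<omega> \<in> space ?P. T \<omega> = enat n} \<omega> \<partial>?P)"
    by (simp only: step)
  also have "\<dots> = (\<integral>\<^sup>+\<omega>. (\<Prod>i = 1..the_enat (T \<omega>). g (\<omega> i)) *
        f (the_enat (T \<omega>)) (restrict \<omega> {1..the_enat (T \<omega>)}) \<partial>?P)"
    using ev fr gp fin_F
    by (intro nn_integral_eq_suminf_stopping[symmetric,
          where f = "\<lambda>n \<omega>. (\<Prod>i = 1..n. g (\<omega> i)) * f n (restrict \<omega> {1..n})"])
      (simp_all add: spaces sets_P measurable_cong_sets[OF sets_P refl] borel_measurable_times_ennreal
        del: One_nat_def)
  finally show ?thesis .
qed

section \<open>The exponential tilt\<close>

lemma tilted_distr_0:
  assumes "real_distribution F"
  shows "tilted_distr F 0 = F"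
proof -
  interpret F: real_distribution F by fact
  show ?thesis
    using tilted_distr_eq_density(1)[OF assms, of 0] by (simp add: F.prob_space[simplified] density_1)
qed

lemma sets_tilted_prob: "sets (tilted_prob F v) = sets seq_space"
  unfolding tilted_prob_def seq_space_def
  by (rule sets_PiM_cong) (simp_all add: tilted_distr_def)

lemma stopped_borel_measurable:
  fixes \<phi> :: "nat \<Rightarrow> real \<Rightarrow> real"
  assumes T: "coord_stopping_time T" and \<phi> [measurable]: "\<And>n. \<phi> n \<in> borel_measurable borel"
  shows "(\<lambda>\<omega>. \<phi> (the_enat (T \<omega>)) (stopped_sum T \<omega>)) \<in> borel_measurable seq_space"
proof (rule measurable_compose_countable)
  show "(\<lambda>\<omega>. the_enat (T \<omega>)) \<in> measurable seq_space (count_space UNIV)"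
    using coord_stopping_time_measurable[OF T] by (rule measurable_compose) simp
  have "(\<lambda>\<omega>. \<phi> n (\<Sum>i = 1..the_enat (T \<omega>). \<omega> i)) \<in> borel_measurable seq_space" for n
  proof (rule measurable_compose[OF _ \<phi>], rule measurable_compose_countable)
    show "(\<lambda>\<omega>. the_enat (T \<omega>)) \<in> measurable seq_space (count_space UNIV)"
      using coord_stopping_time_measurable[OF T] by (rule measurable_compose) simp
    show "(\<lambda>\<omega>. \<Sum>i = 1..m. \<omega> i) \<in> borel_measurable seq_space" for m :: nat
      unfolding seq_space_def by measurable
  qed
  then show "(\<lambda>\<omega>. \<phi> n (stopped_sum T \<omega>)) \<in> borel_measurable seq_space" for n
    by (simp add: stopped_sum_def coord_def)
qed

lemma AE_stopping_time_finite:
  assumes T: "coord_stopping_time T" and M: "prob_space M" "sets M = sets seq_space"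
    and fin: "\<P>(\<omega> in M. T \<omega> < \<infinity>) = 1"
  shows "AE \<omega> in M. T \<omega> < \<infinity>"
proof -
  interpret prob_space M by fact
  have [measurable]: "T \<in> measurable M (count_space UNIV)"
    using coord_stopping_time_measurable[OF T] by (simp add: measurable_cong_sets[OF M(2) refl])
  have "{\<omega> \<in> space M. T \<omega> < \<infinity>} \<in> sets M"
    by measurable
  then have "AE \<omega> in M. \<omega> \<in> {\<omega> \<in> space M. T \<omega> < \<infinity>}"
    using fin by (subst AE_in_set_eq_1)
  then show ?thesis by simp
qed

text \<open>
  The likelihood ratio \<open>u ^ T * exp (v * stopped_sum T)\<close> supplies the power of \<open>u\<close> and shifts the
  exponent from \<open>x - v\<close> to \<open>x\<close>; the base \<open>u\<close> in it is the reciprocal of the normalising constant.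
\<close>

lemma wald_likelihood_ratio_identity:
  fixes F :: "real measure"
  assumes F: "real_distribution F"
    and int: "integrable F (\<lambda>z. exp (v * z))"
    and T: "coord_stopping_time T"
    and u: "0 < u"
    and mgf: "(LINT \<omega>|tilted_prob F 0. exp (v * coord 1 \<omega>)) = inverse u"
    and fin_F: "\<P>(\<omega> in tilted_prob F 0. T \<omega> < \<infinity>) = 1"
    and fin_G: "\<P>(\<omega> in tilted_prob F v. T \<omega> < \<infinity>) = 1"
  shows "(LINT \<omega>|tilted_prob F 0. u ^ the_enat (T \<omega>) * exp (x * stopped_sum T \<omega>)) =
    (LINT \<omega>|tilted_prob F v. exp ((x - v) * stopped_sum T \<omega>))"
proof -
  interpret F: real_distribution F by fact
  define g where "g z = ennreal (u * exp (v * z))" for z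
  have P: "tilted_prob F 0 = PiM {1..} (\<lambda>_. F)"
    by (simp add: tilted_prob_def tilted_distr_0[OF F])
  have "distr (PiM {1::nat..} (\<lambda>_. F)) F (\<lambda>\<omega>. \<omega> 1) = F"
    by (rule distr_PiM_component) (auto intro: F.prob_space_axioms)
  then have "(LINT z|F. exp (v * z)) = (LINT z|distr (PiM {1::nat..} (\<lambda>_. F)) F (\<lambda>\<omega>. \<omega> 1). exp (v * z))"
    by simp
  also have "\<dots> = (LINT \<omega>|PiM {1::nat..} (\<lambda>_. F). exp (v * \<omega> 1))"
    by (rule integral_distr) auto
  finally have c: "(LINT z|F. exp (v * z)) = inverse u"
    using mgf by (simp add: P coord_def)
  have G: "tilted_distr F v = density F g"
    unfolding g_def tilted_distr_eq_density(1)[OF F int] c by (simp add: field_simps)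
  have Q: "tilted_prob F v = PiM {1..} (\<lambda>_. density F g)"
    by (simp add: tilted_prob_def G)
  have G': "real_distribution (density F g)"
    using tilted_distr_eq_density(2)[OF F int] by (simp add: G)
  interpret G: real_distribution "density F g" by fact
  have ps: "prob_space (tilted_prob F 0)" "prob_space (tilted_prob F v)"
    unfolding P Q by (simp_all add: prob_space_PiM F.prob_space_axioms G.prob_space_axioms)
  note AE = AE_stopping_time_finite[OF T ps(1) sets_tilted_prob fin_F, unfolded P]
    AE_stopping_time_finite[OF T ps(2) sets_tilted_prob fin_G, unfolded Q]
  have g: "g \<in> borel_measurable borel"
    unfolding g_def[abs_def] by measurable
  define f where "f n y = ennreal (exp ((x - v) * (\<Sum>i = 1..n. y i)))" for n :: nat and y :: "nat \<Rightarrow> real"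
  have f: "f n \<in> borel_measurable (PiM {1..n} (\<lambda>_. borel))" for n
    unfolding f_def by measurable
  have prod_g: "(\<Prod>i = 1..n. g (\<omega> i)) = ennreal (u ^ n * exp (v * (\<Sum>i = 1..n. \<omega> i)))"
    for n :: nat and \<omega> :: "nat \<Rightarrow> real"
    using u by (simp add: g_def prod_ennreal prod.distrib exp_sum sum_distrib_left)
  have nn: "(\<integral>\<^sup>+\<omega>. ennreal (u ^ the_enat (T \<omega>) * exp (x * stopped_sum T \<omega>)) \<partial>tilted_prob F 0) =
      (\<integral>\<^sup>+\<omega>. ennreal (exp ((x - v) * stopped_sum T \<omega>)) \<partial>tilted_prob F v)"
  proof -
    have "(\<integral>\<^sup>+\<omega>. ennreal (exp ((x - v) * stopped_sum T \<omega>)) \<partial>tilted_prob F v) =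
        (\<integral>\<^sup>+\<omega>. f (the_enat (T \<omega>)) (restrict \<omega> {1..the_enat (T \<omega>)}) \<partial>PiM {1..} (\<lambda>_. density F g))"
      by (simp add: Q f_def stopped_sum_def coord_def)
    also have "\<dots> = (\<integral>\<^sup>+\<omega>. (\<Prod>i = 1..the_enat (T \<omega>). g (\<omega> i)) *
        f (the_enat (T \<omega>)) (restrict \<omega> {1..the_enat (T \<omega>)}) \<partial>PiM {1..} (\<lambda>_. F))"
      by (rule nn_integral_stopped_PiM_density[OF F g G' T f AE])
    also have "\<dots> = (\<integral>\<^sup>+\<omega>. ennreal (u ^ the_enat (T \<omega>) * exp (x * stopped_sum T \<omega>)) \<partial>tilted_prob F 0)"
      unfolding prod_g P
      by (intro nn_integral_cong)
        (use u in \<open>simp add: f_def stopped_sum_def coord_def ennreal_mult'[symmetric]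
          exp_add[symmetric] algebra_simps\<close>)
    finally show ?thesis by simp
  qed
  have "(\<lambda>\<omega>. u ^ the_enat (T \<omega>) * exp (x * stopped_sum T \<omega>)) \<in> borel_measurable (tilted_prob F 0)"
    "(\<lambda>\<omega>. exp ((x - v) * stopped_sum T \<omega>)) \<in> borel_measurable (tilted_prob F v)"
    unfolding measurable_cong_sets[OF sets_tilted_prob refl]
    using stopped_borel_measurable[OF T, of "\<lambda>n s. u ^ n * exp (x * s)"]
      stopped_borel_measurable[OF T, of "\<lambda>n s. exp ((x - v) * s)"]
    by simp_all
  then show ?thesis
    using nn u by (simp add: integral_eq_nn_integral)
qed

theorem corollary3:
  fixes F :: "real measure" and W U :: "real set" and w :: "real \<Rightarrow> real"
    and T :: "(nat \<Rightarrow> real) \<Rightarrow> enat"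
  assumes F: "real_distribution F"
    and W: "is_interval W" "0 \<in> W"
    and mgf: "\<And>v. v \<in> W \<Longrightarrow> integrable F (\<lambda>z. exp (v * z))"
    and T: "coord_stopping_time T"
    and U: "U \<subseteq> {0<..}"
    and w_in: "\<And>u. u \<in> U \<Longrightarrow> w u \<in> W"
    and w_eq: "\<And>u. u \<in> U \<Longrightarrow> (LINT \<omega>|tilted_prob F 0. exp (w u * coord 1 \<omega>)) = inverse u"
    and prob: "\<And>u. u \<in> U \<Longrightarrow> prob_space (tilted_prob F (w u))"
    and T_finite: "\<P>(\<omega> in tilted_prob F 0. T \<omega> < \<infinity>) = 1"
    and T_finite_tilted: "\<And>u. u \<in> U \<Longrightarrow> \<P>(\<omega> in tilted_prob F (w u). T \<omega> < \<infinity>) = 1"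
  shows "(\<forall>u\<in>U. \<forall>x::real.
            integrable (tilted_prob F 0) (\<lambda>\<omega>. u ^ the_enat (T \<omega>) * exp (x * stopped_sum T \<omega>)) \<longrightarrow>
            integrable (tilted_prob F (w u)) (\<lambda>\<omega>. exp ((x - w u) * stopped_sum T \<omega>)) \<longrightarrow>
            (LINT \<omega>|tilted_prob F 0. u ^ the_enat (T \<omega>) * exp (x * stopped_sum T \<omega>)) =
            (LINT \<omega>|tilted_prob F (w u). exp ((x - w u) * stopped_sum T \<omega>))) \<and>
         (\<forall>u\<in>U.
            integrable (tilted_prob F 0) (\<lambda>\<omega>. u ^ the_enat (T \<omega>)) \<longrightarrow>
            integrable (tilted_prob F (w u)) (\<lambda>\<omega>. exp (- w u * stopped_sum T \<omega>)) \<longrightarrow>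
            (LINT \<omega>|tilted_prob F 0. u ^ the_enat (T \<omega>)) =
            (LINT \<omega>|tilted_prob F (w u). exp (- w u * stopped_sum T \<omega>)))"
proof -
  have eq: "(LINT \<omega>|tilted_prob F 0. u ^ the_enat (T \<omega>) * exp (x * stopped_sum T \<omega>)) =
      (LINT \<omega>|tilted_prob F (w u). exp ((x - w u) * stopped_sum T \<omega>))" if u: "u \<in> U" for u x
  proof (rule wald_likelihood_ratio_identity[OF F mgf[OF w_in[OF u]] T _ w_eq[OF u] T_finite
        T_finite_tilted[OF u]])
    show "0 < u" using u U by auto
  qed
  show ?thesis
    using eq eq[where x = 0] by auto
qed

end
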